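(* Assume independent risk factors ($\rho=0$). For given horizon $T>0$, the optimal equity strategies with positive mean-variance trade-off are the functions of the form $$f^S_s=b_0+b_1e^{c_1s}+b_2e^{c_2s}\qquad(0\le s\le T),$$ where $\nu<0$ depends on the prescribed value of the variance $\sigma_T^2$, $c_1=\sqrt{-C/A}>0$, $c_2=-\sqrt{-C/A}$, $b_0=-D/C$, with $$A=1-2\nu,\qquad C=2\nu\left(\alpha-\frac{\sigma_x}{\sigma_S}\right)^2-\alpha^2,\qquad D=\alpha^2\frac{\bar x}{\sigma_S},$$ and $b_1,b_2$ are as follows. For $\alpha\ne\frac12\frac{\sigma_x}{\sigma_S}$, the exponents satisfy $c_1=|c_2|\ne|\alpha|$, and $$\begin{pmatrix}b_1\\ b_2\end{pmatrix}=\begin{pmatrix}\frac{e^{c_1T}}{c_1-\alpha}&\frac{e^{c_2T}}{c_2-\alpha}\\ \frac{\sigma_x}{\sigma_S(c_1+\alpha)-\sigma_x}&\frac{\sigma_x}{\sigma_S(c_2+\alpha)-\sigma_x}\end{pmatrix}^{-1}\begin{pmatrix}\frac{\alpha\bar x}{\sigma_S\left(\alpha^2-2\nu(\alpha-\sigma_x/\sigma_S)^2\right)}\\ -\frac{x_0}{\sigma_S}+\frac{\alpha\bar x}{\sigma_S}\frac{\alpha-2\nu(\alpha-\sigma_x/\sigma_S)}{\alpha^2-2\nu(\alpha-\sigma_x/\sigma_S)^2}\end{pmatrix}.$$ For $\alpha=\frac12\frac{\sigma_x}{\sigma_S}$, the exponents are $c_1=\alpha$ and $c_2=-\alpha$,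 with $$b_1=0,\qquad b_2=\frac{-\frac{x_0}{\sigma_S}+\frac{\bar x}{\sigma_S}\left(1-\frac{4\nu}{1-2\nu}\left(e^{-\alpha T}-1\right)\right)}{2\nu e^{-2\alpha T}-1}.$$
   Context: Parameters: $\alpha,\bar x,x_0\in\mathbb{R}$ and $\sigma_x,\sigma_S>0$. Let $\xi_s=\frac1{\sigma_S}\left(\bar x+e^{-\alpha s}(x_0-\bar x)\right)$. An equity strategy is a continuous deterministic function $f=f^S:[0,T]\to\mathbb{R}$. Its mean and variance functionals are $$\mu_T[f]=\int_0^T\left(\xi_sf_s-\tfrac12 f_s^2\right)ds,\qquad \sigma_T^2[f]=\int_0^T\left[f_u-\frac{\sigma_x}{\sigma_S}\int_u^T f_se^{-\alpha(s-u)}ds\right]^2du .$$ (Background: the equity index satisfies $dS_t/S_t=(r_t+x_t)dt+\sigma_SdW^S_t$ with $dx_t=\alpha(\bar x-x_t)dt-\sigma_xdW^S_t$; when the correlation $\rho$ between the Brownian motion $W^S$ and that driving interest rates is $0$, $\mu_T$ and $\sigma_T^2$ are the mean and variance of the log excess portfolio return on $[0,T]$ due to equity exposure $f$.) An equity strategy is optimal if it maximizes $\mu_T$ among all equity strategies with the same value of $\sigma_T^2$. It is extremal with Lagrange multiplier $\nu\in\mathbb{R}$ if for every continuous $\eta:[0,T]\to\mathbb{R}$, $\frac{d}{d\epsilon}\big|_{\epsilon=0}\left(\mu_T[f+\epsilon\eta]+\nu\,\sigma_T^2[f+\epsilon\eta]\right)=0$; equivalently, $\xi_s-f_s+2\nu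 h_s-2\nu\frac{\sigma_x}{\sigma_S}\int_0^sh_ue^{-\alpha(s-u)}du=0$ for $0\le s\le T$, where $h_u=f_u-\frac{\sigma_x}{\sigma_S}\int_u^Tf_se^{-\alpha(s-u)}ds$. The mean-variance trade-off of such a strategy is $-\nu$, so "optimal with positive mean-variance trade-off" means optimal and extremal with a multiplier $\nu<0$. *)

theory Defs
  imports "HOL-Analysis.Analysis"
begin

text \<open>
  Equity strategies on \<open>[0,T]\<close> are represented by total functions of type
  \<open>real \<Rightarrow> real\<close>; only their values on \<open>{0..T}\<close> enter any of the notions below.
  The functionals are those of independent risk factors (\<open>\<rho> = 0\<close>): for
  \<open>dS\<^sub>t/S\<^sub>t = (r\<^sub>t + x\<^sub>t) dt + \<sigma>S dW\<^sub>t\<close> and \<open>dx\<^sub>t = \<alpha> (xbar - x\<^sub>t) dt - \<sigma>x dW\<^sub>t\<close>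
  they are the mean and the variance of the log excess return due to equity exposure.
\<close>

definition equity_strategy :: "real \<Rightarrow> (real \<Rightarrow> real) \<Rightarrow> bool" where
  "equity_strategy T f \<longleftrightarrow> continuous_on {0..T} f"

definition xi :: "real \<Rightarrow> real \<Rightarrow> real \<Rightarrow> real \<Rightarrow> real \<Rightarrow> real" where
  "xi \<alpha> xbar x0 \<sigma>S s = (1 / \<sigma>S) * (xbar + exp (- \<alpha> * s) * (x0 - xbar))"

definition mean_fn ::
  "real \<Rightarrow> real \<Rightarrow> real \<Rightarrow> real \<Rightarrow> real \<Rightarrow> (real \<Rightarrow> real) \<Rightarrow> real" where
  "mean_fn \<alpha> xbar x0 \<sigma>S T f =
     integral {0..T} (\<lambda>s. xi \<alpha> xbar x0 \<sigma>S s * f s - (1/2) * (f s)\<^sup>2)"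

definition var_fn ::
  "real \<Rightarrow> real \<Rightarrow> real \<Rightarrow> real \<Rightarrow> (real \<Rightarrow> real) \<Rightarrow> real" where
  "var_fn \<alpha> \<sigma>x \<sigma>S T f =
     integral {0..T} (\<lambda>u.
       (f u - (\<sigma>x / \<sigma>S) * integral {u..T} (\<lambda>s. f s * exp (- \<alpha> * (s - u))))\<^sup>2)"

definition optimal_strategy ::
  "real \<Rightarrow> real \<Rightarrow> real \<Rightarrow> real \<Rightarrow> real \<Rightarrow> real \<Rightarrow> (real \<Rightarrow> real) \<Rightarrow> bool" where
  "optimal_strategy \<alpha> xbar x0 \<sigma>x \<sigma>S T f \<longleftrightarrow>
     equity_strategy T f \<and>
     (\<forall>g. equity_strategy T g \<and> var_fn \<alpha> \<sigma>x \<sigma>S T g = var_fn \<alpha> \<sigma>x \<sigma>S T f \<longrightarrow>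
          mean_fn \<alpha> xbar x0 \<sigma>S T g \<le> mean_fn \<alpha> xbar x0 \<sigma>S T f)"

definition extremal_strategy ::
  "real \<Rightarrow> real \<Rightarrow> real \<Rightarrow> real \<Rightarrow> real \<Rightarrow> real \<Rightarrow> real \<Rightarrow> (real \<Rightarrow> real) \<Rightarrow> bool" where
  "extremal_strategy \<alpha> xbar x0 \<sigma>x \<sigma>S T \<nu> f \<longleftrightarrow>
     equity_strategy T f \<and>
     (\<forall>\<eta>. continuous_on {0..T} \<eta> \<longrightarrow>
        ((\<lambda>\<epsilon>. mean_fn \<alpha> xbar x0 \<sigma>S T (\<lambda>s. f s + \<epsilon> * \<eta> s)
              + \<nu> * var_fn \<alpha> \<sigma>x \<sigma>S T (\<lambda>s. f s + \<epsilon> * \<eta> s))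
          has_real_derivative 0) (at 0))"

definition coefA :: "real \<Rightarrow> real" where
  "coefA \<nu> = 1 - 2 * \<nu>"

definition coefC :: "real \<Rightarrow> real \<Rightarrow> real \<Rightarrow> real \<Rightarrow> real" where
  "coefC \<alpha> \<sigma>x \<sigma>S \<nu> = 2 * \<nu> * (\<alpha> - \<sigma>x / \<sigma>S)\<^sup>2 - \<alpha>\<^sup>2"

definition coefD :: "real \<Rightarrow> real \<Rightarrow> real \<Rightarrow> real" where
  "coefD \<alpha> xbar \<sigma>S = \<alpha>\<^sup>2 * (xbar / \<sigma>S)"

definition c1 :: "real \<Rightarrow> real \<Rightarrow> real \<Rightarrow> real \<Rightarrow> real" where
  "c1 \<alpha> \<sigma>x \<sigma>S \<nu> = sqrt (- coefC \<alpha> \<sigma>x \<sigma>S \<nu> / coefA \<nu>)"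

definition c2 :: "real \<Rightarrow> real \<Rightarrow> real \<Rightarrow> real \<Rightarrow> real" where
  "c2 \<alpha> \<sigma>x \<sigma>S \<nu> = - sqrt (- coefC \<alpha> \<sigma>x \<sigma>S \<nu> / coefA \<nu>)"

definition b0 :: "real \<Rightarrow> real \<Rightarrow> real \<Rightarrow> real \<Rightarrow> real \<Rightarrow> real" where
  "b0 \<alpha> xbar \<sigma>x \<sigma>S \<nu> = - coefD \<alpha> xbar \<sigma>S / coefC \<alpha> \<sigma>x \<sigma>S \<nu>"

definition bmat :: "real \<Rightarrow> real \<Rightarrow> real \<Rightarrow> real \<Rightarrow> real \<Rightarrow> real ^ 2 ^ 2" where
  "bmat \<alpha> \<sigma>x \<sigma>S T \<nu> =
     (let c = c1 \<alpha> \<sigma>x \<sigma>S \<nu>; d = c2 \<alpha> \<sigma>x \<sigma>S \<nu>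
      in vector
           [vector [exp (c * T) / (c - \<alpha>), exp (d * T) / (d - \<alpha>)],
            vector [\<sigma>x / (\<sigma>S * (c + \<alpha>) - \<sigma>x), \<sigma>x / (\<sigma>S * (d + \<alpha>) - \<sigma>x)]])"

definition brhs :: "real \<Rightarrow> real \<Rightarrow> real \<Rightarrow> real \<Rightarrow> real \<Rightarrow> real \<Rightarrow> real ^ 2" where
  "brhs \<alpha> xbar x0 \<sigma>x \<sigma>S \<nu> =
     vector
       [\<alpha> * xbar / (\<sigma>S * (\<alpha>\<^sup>2 - 2 * \<nu> * (\<alpha> - \<sigma>x / \<sigma>S)\<^sup>2)),
        - x0 / \<sigma>S + (\<alpha> * xbar / \<sigma>S) *
          ((\<alpha> - 2 * \<nu> * (\<alpha> - \<sigma>x / \<sigma>S)) / (\<alpha>\<^sup>2 - 2 * \<nu> * (\<alpha> - \<sigma>x / \<sigma>S)\<^sup>2))]"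

definition bvec ::
  "real \<Rightarrow> real \<Rightarrow> real \<Rightarrow> real \<Rightarrow> real \<Rightarrow> real \<Rightarrow> real \<Rightarrow> real ^ 2" where
  "bvec \<alpha> xbar x0 \<sigma>x \<sigma>S T \<nu> =
     (if \<alpha> \<noteq> (1/2) * (\<sigma>x / \<sigma>S)
      then matrix_inv (bmat \<alpha> \<sigma>x \<sigma>S T \<nu>) *v brhs \<alpha> xbar x0 \<sigma>x \<sigma>S \<nu>
      else vector
        [0,
         (- x0 / \<sigma>S + (xbar / \<sigma>S) * (1 - (4 * \<nu> / (1 - 2 * \<nu>)) * (exp (- \<alpha> * T) - 1)))
           / (2 * \<nu> * exp (- 2 * \<alpha> * T) - 1)])"

definition explicit_strategy ::
  "real \<Rightarrow> real \<Rightarrow> real \<Rightarrow> real \<Rightarrow> real \<Rightarrow> real \<Rightarrow> real \<Rightarrow> real \<Rightarrow> real" where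
  "explicit_strategy \<alpha> xbar x0 \<sigma>x \<sigma>S T \<nu> s =
     b0 \<alpha> xbar \<sigma>x \<sigma>S \<nu>
     + bvec \<alpha> xbar x0 \<sigma>x \<sigma>S T \<nu> $ 1 * exp (c1 \<alpha> \<sigma>x \<sigma>S \<nu> * s)
     + bvec \<alpha> xbar x0 \<sigma>x \<sigma>S T \<nu> $ 2 * exp (c2 \<alpha> \<sigma>x \<sigma>S \<nu> * s)"

end

theory Submission
  imports Defs
begin

text \<open>
  For \<open>\<nu> < 0\<close> the Lagrangian \<open>mean_fn + \<nu> var_fn\<close> is a strictly concave quadratic functional.
  Hence a strategy with multiplier \<open>\<nu>\<close> is its unique maximizer, which gives optimality, uniqueness
  for given \<open>\<nu>\<close>, and (comparing two strategies of equal variance) uniqueness for given variance.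
  It remains to check that the explicit strategy is extremal. Integration by parts turns
  the first variation into the Euler-Lagrange integral equation, in which the coefficients of
  \<open>1\<close>, \<open>e\<^bsup>c\<^sub>1s\<^esup>\<close>, \<open>e\<^bsup>c\<^sub>2s\<^esup>\<close>, \<open>e\<^bsup>\<alpha>s\<^esup>\<close> and \<open>e\<^bsup>-\<alpha>s\<^esup>\<close> are compared.
\<close>

section \<open>The Volterra operator behind the variance\<close>

text \<open>For \<open>\<kappa>\<close> = \<open>\<sigma>x / \<sigma>S\<close> this is the integrand
  of \<open>var_fn\<close> before squaring, so \<open>var_fn\<close> is the squared L2 norm of a
  linear Volterra operator applied to \<open>f\<close>.\<close>

definition exposure :: "real \<Rightarrow> real \<Rightarrow> real \<Rightarrow> (real \<Rightarrow> real) \<Rightarrow> real \<Rightarrow> real" where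
  "exposure \<alpha> \<kappa> T f u = f u - \<kappa> * integral {u..T} (\<lambda>s. f s * exp (- \<alpha> * (s - u)))"

text \<open>Once the factor depending on \<open>u\<close> is pulled out, \<open>u\<close> enters the
  integral only through its lower limit, so the fundamental theorem of calculus applies.\<close>

lemma discounted_integral_eq:
  fixes f :: "real \<Rightarrow> real"
  shows "integral {u..T} (\<lambda>s. f s * exp (- \<alpha> * (s - u)))
    = exp (\<alpha> * u) * integral {u..T} (\<lambda>s. f s * exp (- \<alpha> * s))"
proof -
  have "(\<lambda>s. f s * exp (- \<alpha> * (s - u))) = (\<lambda>s. exp (\<alpha> * u) * (f s * exp (- \<alpha> * s)))"
    by (auto simp: algebra_simps simp flip: exp_add)
  then show ?thesis by simp
qed

lemma tail_integral_has_derivative: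
  fixes g :: "real \<Rightarrow> real"
  assumes "continuous_on {0..T} g" "u \<in> {0..T}"
  shows "((\<lambda>u. integral {u..T} g) has_real_derivative - g u) (at u within {0..T})"
proof -
  have "((\<lambda>u. integral {0..T} g - integral {0..u} g) has_real_derivative 0 - g u)
      (at u within {0..T})"
    by (intro DERIV_diff DERIV_const integral_has_real_derivative assms)
  moreover have "integral {0..T} g - integral {0..v} g = integral {v..T} g" if "v \<in> {0..T}" for v
    using Henstock_Kurzweil_Integration.integral_combine[of 0 v T g] that
      integrable_continuous_real[OF assms(1)] by auto
  ultimately show ?thesis
    using has_field_derivative_transform_within[OF _ zero_less_one assms(2)] by auto
qed

lemma continuous_on_exposure:
  assumes "continuous_on {0..T} f"
  shows "continuous_on {0..T} (exposure \<alpha> \<kappa> T f)"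
proof -
  have "continuous_on {0..T} (\<lambda>s. f s * exp (- \<alpha> * s))"
    by (intro continuous_intros assms)
  then have "continuous_on {0..T} (\<lambda>u. integral {u..T} (\<lambda>s. f s * exp (- \<alpha> * s)))"
    by (rule DERIV_continuous_on[OF tail_integral_has_derivative])
  then show ?thesis
    unfolding exposure_def discounted_integral_eq
    by (intro continuous_intros assms)
qed

lemma exposure_add_scaled:
  assumes f: "continuous_on {0..T} f" and \<eta>: "continuous_on {0..T} \<eta>" and u: "u \<in> {0..T}"
  shows "exposure \<alpha> \<kappa> T (\<lambda>s. f s + \<epsilon> * \<eta> s) u = exposure \<alpha> \<kappa> T f u + \<epsilon> * exposure \<alpha> \<kappa> T \<eta> u"
proof -
  have sub: "{u..T} \<subseteq> {0..T}" using u by auto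
  let ?e = "\<lambda>s. exp (- \<alpha> * (s - u))"
  have i: "(\<lambda>s. g s * ?e s) integrable_on {u..T}" if "continuous_on {0..T} g" for g
    by (intro integrable_continuous_real continuous_intros continuous_on_subset[OF that sub])
  have "integral {u..T} (\<lambda>s. (f s + \<epsilon> * \<eta> s) * ?e s)
    = integral {u..T} (\<lambda>s. f s * ?e s + \<epsilon> * (\<eta> s * ?e s))"
    by (simp add: algebra_simps)
  also have "\<dots> = integral {u..T} (\<lambda>s. f s * ?e s) + \<epsilon> * integral {u..T} (\<lambda>s. \<eta> s * ?e s)"
    using i[OF f] i[OF \<eta>]
    by (subst Henstock_Kurzweil_Integration.integral_add) (auto intro: integrable_on_mult_right)
  finally show ?thesis
    unfolding exposure_def by (simp add: algebra_simps)
qed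

lemma continuous_on_xi: "continuous_on S (xi \<alpha> xbar x0 \<sigma>S)"
  unfolding xi_def by (intro continuous_intros)

section \<open>Exact quadratic expansion of the Lagrangian\<close>

definition lagrangian ::
  "real \<Rightarrow> real \<Rightarrow> real \<Rightarrow> real \<Rightarrow> real \<Rightarrow> real \<Rightarrow> real \<Rightarrow> (real \<Rightarrow> real) \<Rightarrow> real" where
  "lagrangian \<alpha> xbar x0 \<sigma>x \<sigma>S T \<nu> f
     = mean_fn \<alpha> xbar x0 \<sigma>S T f + \<nu> * var_fn \<alpha> \<sigma>x \<sigma>S T f"

definition first_variation ::
  "real \<Rightarrow> real \<Rightarrow> real \<Rightarrow> real \<Rightarrow> real \<Rightarrow> real \<Rightarrow> real \<Rightarrow> (real \<Rightarrow> real) \<Rightarrow> (real \<Rightarrow> real) \<Rightarrow> real" where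
  "first_variation \<alpha> xbar x0 \<sigma>x \<sigma>S T \<nu> f \<eta> = integral {0..T} (\<lambda>s.
     (xi \<alpha> xbar x0 \<sigma>S s - f s) * \<eta> s
     + 2 * \<nu> * (exposure \<alpha> (\<sigma>x / \<sigma>S) T f s * exposure \<alpha> (\<sigma>x / \<sigma>S) T \<eta> s))"

text \<open>The coefficient of \<open>\<epsilon>\<^sup>2\<close> along
  \<open>f + \<epsilon> \<eta>\<close>, hence half of the second derivative. It does not depend on
  the base strategy \<open>f\<close>.\<close>

definition second_variation ::
  "real \<Rightarrow> real \<Rightarrow> real \<Rightarrow> real \<Rightarrow> real \<Rightarrow> (real \<Rightarrow> real) \<Rightarrow> real" where
  "second_variation \<alpha> \<sigma>x \<sigma>S T \<nu> \<eta> = integral {0..T} (\<lambda>s.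
     \<nu> * (exposure \<alpha> (\<sigma>x / \<sigma>S) T \<eta> s)\<^sup>2 - (\<eta> s)\<^sup>2 / 2)"

lemma lagrangian_eq_integral:
  assumes f: "continuous_on {0..T} f"
  shows "lagrangian \<alpha> xbar x0 \<sigma>x \<sigma>S T \<nu> f = integral {0..T} (\<lambda>s.
     xi \<alpha> xbar x0 \<sigma>S s * f s - (f s)\<^sup>2 / 2 + \<nu> * (exposure \<alpha> (\<sigma>x / \<sigma>S) T f s)\<^sup>2)"
proof -
  have "(\<lambda>s. xi \<alpha> xbar x0 \<sigma>S s * f s - (f s)\<^sup>2 / 2) integrable_on {0..T}"
    by (intro integrable_continuous_real continuous_intros f continuous_on_xi) auto
  moreover have "(\<lambda>s. \<nu> * (exposure \<alpha> (\<sigma>x / \<sigma>S) T f s)\<^sup>2) integrable_on {0..T}"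
    by (intro integrable_continuous_real continuous_intros continuous_on_exposure f)
  ultimately show ?thesis
    unfolding lagrangian_def mean_fn_def var_fn_def exposure_def[symmetric]
    by (simp add: Henstock_Kurzweil_Integration.integral_add)
qed

text \<open>Since \<open>exposure\<close> is linear, the integrand is pointwise a quadratic
  polynomial in \<open>\<epsilon>\<close>. The expansion therefore has no remainder and is valid for
  large \<open>\<epsilon>\<close> too.\<close>

lemma lagrangian_add_scaled:
  assumes f: "continuous_on {0..T} f" and \<eta>: "continuous_on {0..T} \<eta>"
  shows "lagrangian \<alpha> xbar x0 \<sigma>x \<sigma>S T \<nu> (\<lambda>s. f s + \<epsilon> * \<eta> s)
    = lagrangian \<alpha> xbar x0 \<sigma>x \<sigma>S T \<nu> f
      + \<epsilon> * first_variation \<alpha> xbar x0 \<sigma>x \<sigma>S T \<nu> f \<eta>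
      + \<epsilon>\<^sup>2 * second_variation \<alpha> \<sigma>x \<sigma>S T \<nu> \<eta>"
proof -
  let ?\<xi> = "xi \<alpha> xbar x0 \<sigma>S" and ?X = "exposure \<alpha> (\<sigma>x / \<sigma>S) T"
  define P where "P s = ?\<xi> s * f s - (f s)\<^sup>2 / 2 + \<nu> * (?X f s)\<^sup>2" for s
  define Q where "Q s = (?\<xi> s - f s) * \<eta> s + 2 * \<nu> * (?X f s * ?X \<eta> s)" for s
  define R where "R s = \<nu> * (?X \<eta> s)\<^sup>2 - (\<eta> s)\<^sup>2 / 2" for s
  have cont: "continuous_on {0..T} (\<lambda>s. f s + \<epsilon> * \<eta> s)"
    by (intro continuous_intros f \<eta>)
  have int: "P integrable_on {0..T}" "Q integrable_on {0..T}" "R integrable_on {0..T}"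
    unfolding P_def Q_def R_def
    by (intro integrable_continuous_real continuous_intros f \<eta> continuous_on_exposure
        continuous_on_xi; simp)+
  have "lagrangian \<alpha> xbar x0 \<sigma>x \<sigma>S T \<nu> (\<lambda>s. f s + \<epsilon> * \<eta> s)
    = integral {0..T} (\<lambda>s. (P s + \<epsilon> * Q s) + \<epsilon>\<^sup>2 * R s)"
    unfolding lagrangian_eq_integral[OF cont]
    by (intro Henstock_Kurzweil_Integration.integral_cong)
      (simp add: exposure_add_scaled[OF f \<eta>] P_def Q_def R_def power2_eq_square field_simps)
  also have "\<dots> = integral {0..T} P + \<epsilon> * integral {0..T} Q + \<epsilon>\<^sup>2 * integral {0..T} R"
    by (simp add: int integrable_add integrable_on_mult_right
        Henstock_Kurzweil_Integration.integral_add)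
  finally show ?thesis
    using lagrangian_eq_integral[OF f, of \<alpha> xbar x0 \<sigma>x \<sigma>S \<nu>]
    by (simp add: first_variation_def second_variation_def P_def[abs_def] Q_def[abs_def] R_def[abs_def])
qed

text \<open>The derivative at 0 of a quadratic polynomial in \<open>\<epsilon>\<close> is its linear
  coefficient, and derivatives are unique.\<close>

lemma extremal_iff_first_variation:
  "extremal_strategy \<alpha> xbar x0 \<sigma>x \<sigma>S T \<nu> f \<longleftrightarrow> continuous_on {0..T} f
     \<and> (\<forall>\<eta>. continuous_on {0..T} \<eta> \<longrightarrow> first_variation \<alpha> xbar x0 \<sigma>x \<sigma>S T \<nu> f \<eta> = 0)"
proof -
  have "((\<lambda>\<epsilon>. lagrangian \<alpha> xbar x0 \<sigma>x \<sigma>S T \<nu> (\<lambda>s. f s + \<epsilon> * \<eta> s)) has_real_derivative D) (at 0)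
      \<longleftrightarrow> D = first_variation \<alpha> xbar x0 \<sigma>x \<sigma>S T \<nu> f \<eta>"
    if "continuous_on {0..T} f" "continuous_on {0..T} \<eta>" for \<eta> D
  proof -
    have "((\<lambda>\<epsilon>. L + \<epsilon> * F + \<epsilon>\<^sup>2 * S) has_real_derivative F) (at 0)" for L F S :: real
      by (auto intro!: derivative_eq_intros)
    then show ?thesis
      unfolding lagrangian_add_scaled[OF that] using DERIV_unique by blast
  qed
  then show ?thesis
    unfolding extremal_strategy_def equity_strategy_def lagrangian_def by auto
qed

section \<open>Strict concavity: optimality and uniqueness\<close>

lemma second_variation_nonpos:
  assumes "\<nu> < 0" and \<eta>: "continuous_on {0..T} \<eta>"
  shows "second_variation \<alpha> \<sigma>x \<sigma>S T \<nu> \<eta> \<le> 0"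
proof -
  have nonpos: "\<nu> * (exposure \<alpha> (\<sigma>x / \<sigma>S) T \<eta> s)\<^sup>2 \<le> 0" for s
    using assms(1) by (simp add: mult_nonpos_nonneg)
  have "\<nu> * (exposure \<alpha> (\<sigma>x / \<sigma>S) T \<eta> s)\<^sup>2 - (\<eta> s)\<^sup>2 / 2 \<le> 0" for s
    using nonpos[of s] zero_le_power2[of "\<eta> s"] by linarith
  moreover have "(\<lambda>s. \<nu> * (exposure \<alpha> (\<sigma>x / \<sigma>S) T \<eta> s)\<^sup>2 - (\<eta> s)\<^sup>2 / 2) integrable_on {0..T}"
    by (intro integrable_continuous_real continuous_intros \<eta> continuous_on_exposure) simp
  ultimately show ?thesis
    unfolding second_variation_def
    using integral_le[of _ "{0..T}" "\<lambda>_. 0 :: real"] by (simp add: integrable_on_const)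
qed

text \<open>The negated integrand is continuous and nonnegative, so it vanishes pointwise when its
  integral over a nondegenerate interval does. Its summand \<open>(\<eta> s)\<^sup>2 / 2\<close>
  then vanishes as well.\<close>

lemma second_variation_eq_0_imp:
  assumes "\<nu> < 0" "T > 0" and \<eta>: "continuous_on {0..T} \<eta>"
    and 0: "second_variation \<alpha> \<sigma>x \<sigma>S T \<nu> \<eta> = 0" and s: "s \<in> {0..T}"
  shows "\<eta> s = 0"
proof -
  let ?g = "\<lambda>s. (\<eta> s)\<^sup>2 / 2 - \<nu> * (exposure \<alpha> (\<sigma>x / \<sigma>S) T \<eta> s)\<^sup>2"
  have nonpos: "\<nu> * (exposure \<alpha> (\<sigma>x / \<sigma>S) T \<eta> s)\<^sup>2 \<le> 0" for s
    using assms(1) by (simp add: mult_nonpos_nonneg)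
  have "integral {0..T} ?g = - second_variation \<alpha> \<sigma>x \<sigma>S T \<nu> \<eta>"
    unfolding second_variation_def
    by (subst Henstock_Kurzweil_Integration.integral_neg[symmetric]) simp
  then have "integral {0..T} ?g = 0" using 0 by simp
  moreover have "continuous_on {0..T} ?g"
    by (intro continuous_intros \<eta> continuous_on_exposure) simp
  moreover have "?g s \<ge> 0" for s using nonpos[of s] zero_le_power2[of "\<eta> s"] by linarith
  ultimately have "?g s = 0"
    using integral_eq_0_iff[of 0 T ?g] assms(2) s by auto
  then have "(\<eta> s)\<^sup>2 = 0" using nonpos[of s] zero_le_power2[of "\<eta> s"] by linarith
  then show ?thesis by simp
qed

text \<open>The exact expansion is taken at \<open>\<epsilon>\<close> = 1 in the direction
  \<open>g - f\<close>, where the linear term drops out. This turns the local condition on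
  \<open>f\<close> into a comparison with every strategy.\<close>

lemma lagrangian_extremal:
  assumes f: "extremal_strategy \<alpha> xbar x0 \<sigma>x \<sigma>S T \<nu> f" and g: "continuous_on {0..T} g"
  shows "lagrangian \<alpha> xbar x0 \<sigma>x \<sigma>S T \<nu> g
    = lagrangian \<alpha> xbar x0 \<sigma>x \<sigma>S T \<nu> f + second_variation \<alpha> \<sigma>x \<sigma>S T \<nu> (\<lambda>s. g s - f s)"
proof -
  have cf: "continuous_on {0..T} f" using f by (simp add: extremal_iff_first_variation)
  have \<eta>: "continuous_on {0..T} (\<lambda>s. g s - f s)"
    by (intro continuous_intros cf g)
  then have "first_variation \<alpha> xbar x0 \<sigma>x \<sigma>S T \<nu> f (\<lambda>s. g s - f s) = 0"
    using f by (simp add: extremal_iff_first_variation)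
  then show ?thesis
    using lagrangian_add_scaled[OF cf \<eta>, of \<alpha> xbar x0 \<sigma>x \<sigma>S \<nu> 1] by simp
qed

text \<open>Among strategies of equal variance the terms \<open>\<nu> * var_fn\<close> agree, so
  comparing Lagrangians means comparing means.\<close>

lemma extremal_imp_optimal:
  assumes "\<nu> < 0" and f: "extremal_strategy \<alpha> xbar x0 \<sigma>x \<sigma>S T \<nu> f"
  shows "optimal_strategy \<alpha> xbar x0 \<sigma>x \<sigma>S T f"
  unfolding optimal_strategy_def equity_strategy_def
proof (intro conjI allI impI)
  show cf: "continuous_on {0..T} f" using f by (simp add: extremal_iff_first_variation)
  fix g assume g: "continuous_on {0..T} g \<and> var_fn \<alpha> \<sigma>x \<sigma>S T g = var_fn \<alpha> \<sigma>x \<sigma>S T f"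
  then have "second_variation \<alpha> \<sigma>x \<sigma>S T \<nu> (\<lambda>s. g s - f s) \<le> 0"
    by (intro second_variation_nonpos assms(1) continuous_intros cf) auto
  then show "mean_fn \<alpha> xbar x0 \<sigma>S T g \<le> mean_fn \<alpha> xbar x0 \<sigma>S T f"
    using lagrangian_extremal[OF f, of g] g by (simp add: lagrangian_def)
qed

text \<open>The second variation at \<open>g - f\<close> is nonpositive by concavity and nonnegative
  by \<open>ge\<close>, hence zero.\<close>

lemma lagrangian_maximizer_unique:
  assumes "\<nu> < 0" "T > 0" and f: "extremal_strategy \<alpha> xbar x0 \<sigma>x \<sigma>S T \<nu> f"
    and g: "continuous_on {0..T} g"
    and ge: "lagrangian \<alpha> xbar x0 \<sigma>x \<sigma>S T \<nu> g \<ge> lagrangian \<alpha> xbar x0 \<sigma>x \<sigma>S T \<nu> f"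
    and s: "s \<in> {0..T}"
  shows "g s = f s"
proof -
  have \<eta>: "continuous_on {0..T} (\<lambda>s. g s - f s)"
    using f g by (simp add: extremal_iff_first_variation continuous_on_diff)
  have "second_variation \<alpha> \<sigma>x \<sigma>S T \<nu> (\<lambda>s. g s - f s) = 0"
    using second_variation_nonpos[OF assms(1) \<eta>, of \<alpha> \<sigma>x \<sigma>S] lagrangian_extremal[OF f g] ge by simp
  then show ?thesis
    using second_variation_eq_0_imp[OF assms(1,2) \<eta> _ s] by simp
qed

lemma extremal_unique:
  assumes "\<nu> < 0" "T > 0" and f: "extremal_strategy \<alpha> xbar x0 \<sigma>x \<sigma>S T \<nu> f"
    and g: "extremal_strategy \<alpha> xbar x0 \<sigma>x \<sigma>S T \<nu> g" and s: "s \<in> {0..T}"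
  shows "g s = f s"
proof -
  have c: "continuous_on {0..T} f" "continuous_on {0..T} g"
    using f g by (simp_all add: extremal_iff_first_variation)
  have "lagrangian \<alpha> xbar x0 \<sigma>x \<sigma>S T \<nu> g \<ge> lagrangian \<alpha> xbar x0 \<sigma>x \<sigma>S T \<nu> f"
    unfolding lagrangian_extremal[OF g c(1)]
    using second_variation_nonpos[OF assms(1), of T "\<lambda>s. f s - g s"] c
    by (simp add: continuous_on_diff)
  then show ?thesis using lagrangian_maximizer_unique[OF assms(1,2) f c(2) _ s] by simp
qed

text \<open>Here \<open>f\<close> serves as a competitor of the optimal \<open>g\<close>: equal
  variances turn the inequality of means into one of Lagrangians. No multiplier of \<open>g\<close>
  enters, so two strategies with different multipliers but the same variance must coincide.\<close>

lemma extremal_unique_of_variance: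
  assumes "\<nu> < 0" "T > 0" and f: "extremal_strategy \<alpha> xbar x0 \<sigma>x \<sigma>S T \<nu> f"
    and g: "optimal_strategy \<alpha> xbar x0 \<sigma>x \<sigma>S T g"
    and v: "var_fn \<alpha> \<sigma>x \<sigma>S T f = var_fn \<alpha> \<sigma>x \<sigma>S T g" and s: "s \<in> {0..T}"
  shows "g s = f s"
proof (rule lagrangian_maximizer_unique[OF assms(1,2) f _ _ s])
  show "continuous_on {0..T} g"
    using g by (simp add: optimal_strategy_def equity_strategy_def)
  have "continuous_on {0..T} f" using f by (simp add: extremal_iff_first_variation)
  then show "lagrangian \<alpha> xbar x0 \<sigma>x \<sigma>S T \<nu> g \<ge> lagrangian \<alpha> xbar x0 \<sigma>x \<sigma>S T \<nu> f"
    using g v by (simp add: optimal_strategy_def equity_strategy_def lagrangian_def)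
qed

section \<open>The adjoint operator and the Euler-Lagrange equation\<close>

text \<open>The L2 adjoint of \<open>exposure\<close> integrates over the past instead of the
  future. Integration by parts with the antiderivatives \<open>G\<close> and \<open>F\<close>
  replaces an exchange of the order of integration.\<close>

lemma integral_exposure_adjoint:
  assumes "T > 0" and h: "continuous_on {0..T} h" and \<eta>: "continuous_on {0..T} \<eta>"
  shows "integral {0..T} (\<lambda>s. h s * exposure \<alpha> \<kappa> T \<eta> s)
    = integral {0..T} (\<lambda>s. (h s - \<kappa> * integral {0..s} (\<lambda>u. h u * exp (- \<alpha> * (s - u)))) * \<eta> s)"
proof -
  define G where "G s = integral {0..s} (\<lambda>u. h u * exp (\<alpha> * u))" for s
  define F where "F u = integral {u..T} (\<lambda>s. \<eta> s * exp (- \<alpha> * s))" for u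
  have dG: "(G has_real_derivative h s * exp (\<alpha> * s)) (at s within {0..T})" if "s \<in> {0..T}" for s
    unfolding G_def
    by (rule integral_has_real_derivative[OF _ that]) (intro continuous_intros h)
  have dF: "(F has_real_derivative - (\<eta> s * exp (- \<alpha> * s))) (at s within {0..T})"
    if "s \<in> {0..T}" for s
    unfolding F_def
    by (rule tail_integral_has_derivative[OF _ that]) (intro continuous_intros \<eta>)
  have cF: "continuous_on {0..T} F" and cG: "continuous_on {0..T} G"
    by (rule DERIV_continuous_on[OF dF], assumption) (rule DERIV_continuous_on[OF dG])
  have G: "integral {0..s} (\<lambda>u. h u * exp (- \<alpha> * (s - u))) = exp (- \<alpha> * s) * G s" for s
  proof -
    have "(\<lambda>u. h u * exp (- \<alpha> * (s - u))) = (\<lambda>u. exp (- \<alpha> * s) * (h u * exp (\<alpha> * u)))"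
      by (auto simp: algebra_simps simp flip: exp_add)
    then show ?thesis by (simp add: G_def)
  qed
  have F: "exposure \<alpha> \<kappa> T \<eta> s = \<eta> s - \<kappa> * (exp (\<alpha> * s) * F s)" for s
    unfolding exposure_def discounted_integral_eq F_def by simp
  let ?d = "\<lambda>s. h s * exp (\<alpha> * s) * F s - G s * (\<eta> s * exp (- \<alpha> * s))"
  have "((\<lambda>s. G s * F s) has_real_derivative ?d s) (at s within {0..T})" if "s \<in> {0..T}" for s
    using DERIV_mult'[OF dG[OF that] dF[OF that]] by (simp add: algebra_simps)
  then have "(?d has_integral G T * F T - G 0 * F 0) {0..T}"
    using assms(1) by (intro fundamental_theorem_of_calculus)
      (auto simp: has_real_derivative_iff_has_vector_derivative)
  \<comment> \<open>The boundary terms vanish because \<open>G 0 = 0\<close> and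
    \<open>F T = 0\<close>.\<close>
  then have d0: "integral {0..T} ?d = 0"
    by (simp add: integral_unique G_def F_def)
  let ?l = "\<lambda>s. h s * exposure \<alpha> \<kappa> T \<eta> s"
  \<comment> \<open>The two integrands to be compared differ exactly by \<open>\<kappa>\<close>
    times the derivative of \<open>G s * F s\<close>.\<close>
  have "integral {0..T} (\<lambda>s. (h s - \<kappa> * (exp (- \<alpha> * s) * G s)) * \<eta> s)
      = integral {0..T} (\<lambda>s. ?l s + \<kappa> * ?d s)"
    by (intro Henstock_Kurzweil_Integration.integral_cong) (simp add: F algebra_simps)
  also have "\<dots> = integral {0..T} ?l + integral {0..T} (\<lambda>s. \<kappa> * ?d s)"
    by (intro Henstock_Kurzweil_Integration.integral_add integrable_continuous_real
        continuous_intros continuous_on_exposure h \<eta> cF cG)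
  finally show ?thesis unfolding G using d0 by simp
qed

text \<open>The adjoint moves \<open>exposure\<close> off \<open>\<eta>\<close>, and the first
  variation becomes the integral of the left side of \<open>el\<close> times \<open>\<eta>\<close>.
  Sufficiency is the direction used for the explicit strategy; \<open>extremal_unique\<close> then
  shows that no other strategy has the same multiplier.\<close>

lemma extremal_if_euler_lagrange:
  assumes "T > 0" and f: "continuous_on {0..T} f"
    and el: "\<And>s. s \<in> {0..T} \<Longrightarrow> xi \<alpha> xbar x0 \<sigma>S s - f s
      + 2 * \<nu> * (exposure \<alpha> (\<sigma>x / \<sigma>S) T f s - \<sigma>x / \<sigma>S *
          integral {0..s} (\<lambda>u. exposure \<alpha> (\<sigma>x / \<sigma>S) T f u * exp (- \<alpha> * (s - u)))) = 0"
  shows "extremal_strategy \<alpha> xbar x0 \<sigma>x \<sigma>S T \<nu> f"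
  unfolding extremal_iff_first_variation
proof (intro conjI allI impI f)
  fix \<eta> :: "real \<Rightarrow> real" assume \<eta>: "continuous_on {0..T} \<eta>"
  let ?h = "exposure \<alpha> (\<sigma>x / \<sigma>S) T f" and ?\<xi> = "xi \<alpha> xbar x0 \<sigma>S"
  have h: "continuous_on {0..T} ?h" by (rule continuous_on_exposure[OF f])
  have "first_variation \<alpha> xbar x0 \<sigma>x \<sigma>S T \<nu> f \<eta>
    = integral {0..T} (\<lambda>s. (?\<xi> s - f s) * \<eta> s)
      + 2 * \<nu> * integral {0..T} (\<lambda>s. ?h s * exposure \<alpha> (\<sigma>x / \<sigma>S) T \<eta> s)"
    unfolding first_variation_def
    by (subst Henstock_Kurzweil_Integration.integral_add)
      (auto intro!: integrable_continuous_real continuous_intros \<eta> f h continuous_on_xi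
        continuous_on_exposure)
  also have "2 * \<nu> * integral {0..T} (\<lambda>s. ?h s * exposure \<alpha> (\<sigma>x / \<sigma>S) T \<eta> s)
    = integral {0..T} (\<lambda>s. 2 * \<nu> * ((?h s - \<sigma>x / \<sigma>S *
        integral {0..s} (\<lambda>u. ?h u * exp (- \<alpha> * (s - u)))) * \<eta> s))"
    by (simp add: integral_exposure_adjoint[OF assms(1) h \<eta>])
  also have "\<dots> = integral {0..T} (\<lambda>s. - ((?\<xi> s - f s) * \<eta> s))"
  proof (intro Henstock_Kurzweil_Integration.integral_cong)
    fix s assume "s \<in> {0..T}"
    then have "2 * \<nu> * (?h s - \<sigma>x / \<sigma>S * integral {0..s} (\<lambda>u. ?h u * exp (- \<alpha> * (s - u))))
        = - (?\<xi> s - f s)"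
      using el[of s] by simp
    then show "2 * \<nu> * ((?h s - \<sigma>x / \<sigma>S *
        integral {0..s} (\<lambda>u. ?h u * exp (- \<alpha> * (s - u)))) * \<eta> s) = - ((?\<xi> s - f s) * \<eta> s)"
      by (metis mult.assoc mult_minus_left)
  qed
  finally show "first_variation \<alpha> xbar x0 \<sigma>x \<sigma>S T \<nu> f \<eta> = 0" by simp
qed

section \<open>Action of the integral operators on sums of exponentials\<close>

text \<open>The alternative \<open>p = 0\<close> admits a vanishing rate \<open>m\<close>: both
  sides are then 0, whatever the quotient by \<open>m\<close> means. It lets later sums carry dummy
  terms.\<close>

lemma has_integral_exp_affine:
  fixes p m r a b :: real
  assumes "a \<le> b" "p = 0 \<or> m \<noteq> 0"
  shows "((\<lambda>s. p * exp (m * s + r)) has_integral p / m * (exp (m * b + r) - exp (m * a + r))) {a..b}"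
proof (cases "p = 0")
  case False
  then have "m \<noteq> 0" using assms by simp
  then have "((\<lambda>s. p / m * exp (m * s + r)) has_vector_derivative p * exp (m * s + r))
      (at s within {a..b})" for s
    unfolding has_real_derivative_iff_has_vector_derivative[symmetric]
    by (auto intro!: derivative_eq_intros)
  from fundamental_theorem_of_calculus[OF assms(1) this] show ?thesis
    by (simp add: right_diff_distrib)
qed simp

text \<open>Each \<open>exp (m * s)\<close> is an eigenfunction with factor
  \<open>1 + \<kappa> / (m - \<alpha>)\<close>, up to a multiple of
  \<open>exp (\<alpha> * u)\<close> coming from the upper limit \<open>T\<close>; the constant is
  the case \<open>m = 0\<close>. The last bracket collects these horizon terms.\<close>

lemma exposure_exp_sum:
  assumes u: "u \<in> {0..T}"
    and f: "\<And>s. s \<in> {0..T} \<Longrightarrow> f s = p\<^sub>0 + p\<^sub>1 * exp (c * s) + p\<^sub>2 * exp (d * s)"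
    and "p\<^sub>0 = 0 \<or> \<alpha> \<noteq> 0" "p\<^sub>1 = 0 \<or> c \<noteq> \<alpha>" "p\<^sub>2 = 0 \<or> d \<noteq> \<alpha>"
  shows "exposure \<alpha> \<kappa> T f u
    = p\<^sub>0 * (1 - \<kappa> / \<alpha>) + p\<^sub>1 * (1 + \<kappa> / (c - \<alpha>)) * exp (c * u)
      + p\<^sub>2 * (1 + \<kappa> / (d - \<alpha>)) * exp (d * u)
      - \<kappa> * exp (\<alpha> * (u - T)) * (p\<^sub>1 * exp (c * T) / (c - \<alpha>) + p\<^sub>2 * exp (d * T) / (d - \<alpha>) - p\<^sub>0 / \<alpha>)"
proof -
  have I: "((\<lambda>s. p * exp ((m - \<alpha>) * s + \<alpha> * u)) has_integral
      p / (m - \<alpha>) * (exp (m * T) * exp (\<alpha> * (u - T)) - exp (m * u))) {u..T}"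
    if "p = 0 \<or> m \<noteq> \<alpha>" for p m
  proof -
    have "exp ((m - \<alpha>) * T + \<alpha> * u) = exp (m * T) * exp (\<alpha> * (u - T))"
      "exp ((m - \<alpha>) * u + \<alpha> * u) = exp (m * u)"
      by (simp_all add: algebra_simps flip: exp_add)
    then show ?thesis
      using has_integral_exp_affine[of u T p "m - \<alpha>" "\<alpha> * u"] u that by simp
  qed
  have "((\<lambda>s. p\<^sub>0 * exp ((0 - \<alpha>) * s + \<alpha> * u) + p\<^sub>1 * exp ((c - \<alpha>) * s + \<alpha> * u)
        + p\<^sub>2 * exp ((d - \<alpha>) * s + \<alpha> * u)) has_integral
      p\<^sub>0 / (0 - \<alpha>) * (exp (0 * T) * exp (\<alpha> * (u - T)) - exp (0 * u))
      + p\<^sub>1 / (c - \<alpha>) * (exp (c * T) * exp (\<alpha> * (u - T)) - exp (c * u))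
      + p\<^sub>2 / (d - \<alpha>) * (exp (d * T) * exp (\<alpha> * (u - T)) - exp (d * u))) {u..T}"
    using assms(3-) by (intro has_integral_add I) auto
  moreover have "integral {u..T} (\<lambda>s. f s * exp (- \<alpha> * (s - u))) = integral {u..T}
      (\<lambda>s. p\<^sub>0 * exp ((0 - \<alpha>) * s + \<alpha> * u) + p\<^sub>1 * exp ((c - \<alpha>) * s + \<alpha> * u)
        + p\<^sub>2 * exp ((d - \<alpha>) * s + \<alpha> * u))"
    using u f by (intro Henstock_Kurzweil_Integration.integral_cong)
      (simp add: algebra_simps flip: exp_add)
  ultimately have I': "integral {u..T} (\<lambda>s. f s * exp (- \<alpha> * (s - u)))
    = p\<^sub>0 / (0 - \<alpha>) * (exp (0 * T) * exp (\<alpha> * (u - T)) - exp (0 * u))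
      + p\<^sub>1 / (c - \<alpha>) * (exp (c * T) * exp (\<alpha> * (u - T)) - exp (c * u))
      + p\<^sub>2 / (d - \<alpha>) * (exp (d * T) * exp (\<alpha> * (u - T)) - exp (d * u))"
    by (simp only: integral_unique)
  show ?thesis
    unfolding exposure_def f[OF u] I'
    by (simp add: algebra_simps diff_divide_distrib add_divide_distrib)
qed

text \<open>The counterpart for the past: the lower limit 0 contributes multiples of
  \<open>exp (- \<alpha> * s)\<close>. The fourth summand of \<open>h\<close> accommodates the
  horizon term that \<open>exposure\<close> may leave behind.\<close>

lemma discounted_past_integral_exp_sum:
  fixes s :: real
  assumes s: "s \<in> {0..T}"
    and h: "\<And>u. u \<in> {0..T} \<Longrightarrow>
      h u = q\<^sub>0 + q\<^sub>1 * exp (c * u) + q\<^sub>2 * exp (d * u) + q\<^sub>3 * exp (\<alpha> * u)"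
    and "q\<^sub>0 = 0 \<or> \<alpha> \<noteq> 0" "q\<^sub>1 = 0 \<or> c \<noteq> - \<alpha>" "q\<^sub>2 = 0 \<or> d \<noteq> - \<alpha>" "q\<^sub>3 = 0 \<or> \<alpha> \<noteq> 0"
  shows "integral {0..s} (\<lambda>u. h u * exp (- \<alpha> * (s - u)))
    = q\<^sub>0 / \<alpha> * (1 - exp (- \<alpha> * s)) + q\<^sub>1 / (c + \<alpha>) * (exp (c * s) - exp (- \<alpha> * s))
      + q\<^sub>2 / (d + \<alpha>) * (exp (d * s) - exp (- \<alpha> * s))
      + q\<^sub>3 / (2 * \<alpha>) * (exp (\<alpha> * s) - exp (- \<alpha> * s))"
proof -
  have I: "((\<lambda>u. q * exp ((m + \<alpha>) * u + - \<alpha> * s)) has_integral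
      q / (m + \<alpha>) * (exp (m * s) - exp (- \<alpha> * s))) {0..s}"
    if "q = 0 \<or> m \<noteq> - \<alpha>" for q m
  proof -
    have "exp ((m + \<alpha>) * s + - \<alpha> * s) = exp (m * s)"
      by (simp add: algebra_simps)
    then show ?thesis
      using has_integral_exp_affine[of 0 s q "m + \<alpha>" "- \<alpha> * s"] s that
      by (simp add: eq_neg_iff_add_eq_0)
  qed
  have "((\<lambda>u. q\<^sub>0 * exp ((0 + \<alpha>) * u + - \<alpha> * s) + q\<^sub>1 * exp ((c + \<alpha>) * u + - \<alpha> * s)
        + q\<^sub>2 * exp ((d + \<alpha>) * u + - \<alpha> * s) + q\<^sub>3 * exp ((\<alpha> + \<alpha>) * u + - \<alpha> * s)) has_integral
      q\<^sub>0 / (0 + \<alpha>) * (exp (0 * s) - exp (- \<alpha> * s))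
      + q\<^sub>1 / (c + \<alpha>) * (exp (c * s) - exp (- \<alpha> * s))
      + q\<^sub>2 / (d + \<alpha>) * (exp (d * s) - exp (- \<alpha> * s))
      + q\<^sub>3 / (\<alpha> + \<alpha>) * (exp (\<alpha> * s) - exp (- \<alpha> * s))) {0..s}"
    using assms(3-) by (intro has_integral_add I) auto
  moreover have "integral {0..s} (\<lambda>u. h u * exp (- \<alpha> * (s - u))) = integral {0..s}
      (\<lambda>u. q\<^sub>0 * exp ((0 + \<alpha>) * u + - \<alpha> * s) + q\<^sub>1 * exp ((c + \<alpha>) * u + - \<alpha> * s)
        + q\<^sub>2 * exp ((d + \<alpha>) * u + - \<alpha> * s) + q\<^sub>3 * exp ((\<alpha> + \<alpha>) * u + - \<alpha> * s))"
    using s h by (intro Henstock_Kurzweil_Integration.integral_cong)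
      (simp add: algebra_simps flip: exp_add)
  ultimately show ?thesis by (simp add: integral_unique)
qed

text \<open>The hypothesis on \<open>c\<^sup>2\<close> factors as a difference of squares on each
  side, and dividing by \<open>(c - \<alpha>) * (c + \<alpha> - \<kappa>)\<close> gives the claim.
  It is what cancels \<open>exp (c * s)\<close> in the Euler-Lagrange equation.\<close>

lemma characteristic_identity:
  fixes c \<alpha> \<kappa> \<nu> :: real
  assumes "(1 - 2 * \<nu>) * c\<^sup>2 = \<alpha>\<^sup>2 - 2 * \<nu> * (\<alpha> - \<kappa>)\<^sup>2"
    and "c \<noteq> \<alpha>" "c \<noteq> - \<alpha>" "c + \<alpha> \<noteq> \<kappa>"
  shows "2 * \<nu> * (1 + \<kappa> / (c - \<alpha>)) = (c + \<alpha>) / (c + \<alpha> - \<kappa>)"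
proof -
  have nz: "c - \<alpha> \<noteq> 0" "c + \<alpha> - \<kappa> \<noteq> 0" using assms by auto
  have "2 * \<nu> * (c - \<alpha> + \<kappa>) * (c + \<alpha> - \<kappa>) = (c + \<alpha>) * (c - \<alpha>)"
    using assms(1) by (simp add: algebra_simps power2_eq_square)
  then show ?thesis using nz by (simp add: field_simps)
qed

text \<open>Each hypothesis removes one function from the Euler-Lagrange equation: the quadratic
  equations for \<open>c\<close> and \<open>d\<close> remove their exponentials, \<open>p0\<close>
  the constant, \<open>r1\<close> the horizon term \<open>exp (\<alpha> * s)\<close>, and
  \<open>r2\<close> the term \<open>exp (- \<alpha> * s)\<close>.\<close>

lemma extremal_exp_sum:
  fixes \<alpha> \<sigma>x \<sigma>S \<nu> c d xbar x0 T p\<^sub>0 p\<^sub>1 p\<^sub>2 :: real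
  defines "\<kappa> \<equiv> \<sigma>x / \<sigma>S"
  defines "N \<equiv> \<alpha>\<^sup>2 - 2 * \<nu> * (\<alpha> - \<kappa>)\<^sup>2"
  assumes "T > 0" "N \<noteq> 0"
    and c: "(1 - 2 * \<nu>) * c\<^sup>2 = N" "c \<noteq> \<alpha>" "c \<noteq> - \<alpha>" "c + \<alpha> \<noteq> \<kappa>"
    and d: "(1 - 2 * \<nu>) * d\<^sup>2 = N" "d \<noteq> \<alpha>" "d \<noteq> - \<alpha>" "d + \<alpha> \<noteq> \<kappa>"
    and p0: "p\<^sub>0 = \<alpha>\<^sup>2 * (xbar / \<sigma>S) / N"
    and r1: "p\<^sub>1 * exp (c * T) / (c - \<alpha>) + p\<^sub>2 * exp (d * T) / (d - \<alpha>) = \<alpha> * (xbar / \<sigma>S) / N"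
    and r2: "p\<^sub>1 * \<kappa> / (c + \<alpha> - \<kappa>) + p\<^sub>2 * \<kappa> / (d + \<alpha> - \<kappa>)
      = - x0 / \<sigma>S + (xbar / \<sigma>S) * \<alpha> * (\<alpha> - 2 * \<nu> * (\<alpha> - \<kappa>)) / N"
    and f: "\<And>s. s \<in> {0..T} \<Longrightarrow> f s = p\<^sub>0 + p\<^sub>1 * exp (c * s) + p\<^sub>2 * exp (d * s)"
  shows "extremal_strategy \<alpha> xbar x0 \<sigma>x \<sigma>S T \<nu> f"
proof (rule extremal_if_euler_lagrange[OF \<open>T > 0\<close>])
  have "continuous_on {0..T} (\<lambda>s. p\<^sub>0 + p\<^sub>1 * exp (c * s) + p\<^sub>2 * exp (d * s))"
    by (intro continuous_intros)
  then show "continuous_on {0..T} f"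
    by (rule continuous_on_eq) (simp add: f)
  \<comment> \<open>This makes the quotients by \<open>\<alpha>\<close> harmless: the constant term
    is absent when \<open>\<alpha>\<close> is 0.\<close>
  have p0\<alpha>: "p\<^sub>0 = 0 \<or> \<alpha> \<noteq> 0" using p0 by auto
  define y z where "y = xbar / \<sigma>S" and "z = x0 / \<sigma>S"
  have "p\<^sub>0 / \<alpha> = \<alpha> * y / N"
    by (simp add: p0 y_def power2_eq_square)
  \<comment> \<open>By \<open>r1\<close> the horizon bracket is zero; the summand with coefficient 0
    only fits the shape of \<open>discounted_past_integral_exp_sum\<close>.\<close>
  then have h: "exposure \<alpha> \<kappa> T f u = p\<^sub>0 * (1 - \<kappa> / \<alpha>) + p\<^sub>1 * (1 + \<kappa> / (c - \<alpha>)) * exp (c * u)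
      + p\<^sub>2 * (1 + \<kappa> / (d - \<alpha>)) * exp (d * u) + 0 * exp (\<alpha> * u)" if "u \<in> {0..T}" for u
    using exposure_exp_sum[OF that f, where \<alpha> = \<alpha> and \<kappa> = \<kappa>] c d p0\<alpha> r1 by (simp add: y_def)
  fix s assume s: "s \<in> {0..T}"
  let ?E = "exp (- \<alpha> * s)"
  define a b where "a = 1 / (c + \<alpha> - \<kappa>)" and "b = 1 / (d + \<alpha> - \<kappa>)"
  have ca: "2 * \<nu> * (1 + \<kappa> / (c - \<alpha>)) = (c + \<alpha>) * a" and a1: "a * (c + \<alpha> - \<kappa>) = 1"
    using characteristic_identity[of \<nu> c \<alpha> \<kappa>] c by (simp_all add: N_def a_def)
  have db: "2 * \<nu> * (1 + \<kappa> / (d - \<alpha>)) = (d + \<alpha>) * b" and b1: "b * (d + \<alpha> - \<kappa>) = 1"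
    using characteristic_identity[of \<nu> d \<alpha> \<kappa>] d by (simp_all add: N_def b_def)
  \<comment> \<open>For each exponential the terms in \<open>e\<close> cancel, and only a multiple
    of \<open>?E\<close> from the lower limit 0 survives.\<close>
  have exp_term: "- p * e + 2 * \<nu> * (p * g * e - \<kappa> * (p * g / (m + \<alpha>) * (e - ?E))) = \<kappa> * p * w * ?E"
    if "2 * \<nu> * g = (m + \<alpha>) * w" "w * (m + \<alpha> - \<kappa>) = 1" "m + \<alpha> \<noteq> 0" for p e g m w
  proof -
    have "2 * \<nu> * (p * g * e - \<kappa> * (p * g / (m + \<alpha>) * (e - ?E)))
      = (2 * \<nu> * g) * p * e - \<kappa> * p * (2 * \<nu> * g) / (m + \<alpha>) * (e - ?E)"
      by (simp add: algebra_simps)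
    also have "\<dots> = (m + \<alpha>) * w * p * e - \<kappa> * p * w * (e - ?E)"
      unfolding that(1) using that(3) by simp
    also have "\<dots> = p * e * (w * (m + \<alpha> - \<kappa>)) + \<kappa> * p * w * ?E"
      by (simp add: algebra_simps)
    finally show ?thesis using that(2) by simp
  qed
  \<comment> \<open>The remaining constant and \<open>?E\<close> terms, with the right side of
    \<open>r2\<close> standing for the sum of the two residues from \<open>exp_term\<close>.\<close>
  have const_term: "y + ?E * (z - y) - p\<^sub>0
      + 2 * \<nu> * (p\<^sub>0 * (1 - \<kappa> / \<alpha>) - \<kappa> * (p\<^sub>0 * (1 - \<kappa> / \<alpha>) / \<alpha> * (1 - ?E)))
      + (- z + y * \<alpha> * (\<alpha> - 2 * \<nu> * (\<alpha> - \<kappa>)) / N) * ?E = 0"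
  proof (cases "\<alpha> = 0")
    case True
    then show ?thesis using p0 by simp
  next
    case False
    \<comment> \<open>In terms of \<open>t\<close> every quotient by \<open>N\<close> or
      \<open>\<alpha>\<close> disappears, and a polynomial identity remains.\<close>
    define t where "t = y / N"
    have y: "y = t * (\<alpha>\<^sup>2 - 2 * \<nu> * (\<alpha> - \<kappa>)\<^sup>2)"
      using \<open>N \<noteq> 0\<close> by (simp add: t_def flip: N_def)
    have p: "p\<^sub>0 = t * \<alpha>\<^sup>2"
      by (simp add: p0 t_def y_def)
    have p': "p\<^sub>0 * (1 - \<kappa> / \<alpha>) = t * \<alpha> * (\<alpha> - \<kappa>)"
      using False by (simp add: p field_simps power2_eq_square)
    have q: "p\<^sub>0 * (1 - \<kappa> / \<alpha>) / \<alpha> = t * (\<alpha> - \<kappa>)"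
      using False by (simp add: p')
    have r: "y * \<alpha> * (\<alpha> - 2 * \<nu> * (\<alpha> - \<kappa>)) / N = t * \<alpha> * (\<alpha> - 2 * \<nu> * (\<alpha> - \<kappa>))"
      by (simp add: t_def)
    show ?thesis
      unfolding r q unfolding p' unfolding p by (simp add: y algebra_simps power2_eq_square)
  qed
  have F: "integral {0..s} (\<lambda>u. exposure \<alpha> \<kappa> T f u * exp (- \<alpha> * (s - u)))
    = p\<^sub>0 * (1 - \<kappa> / \<alpha>) / \<alpha> * (1 - ?E)
      + p\<^sub>1 * (1 + \<kappa> / (c - \<alpha>)) / (c + \<alpha>) * (exp (c * s) - ?E)
      + p\<^sub>2 * (1 + \<kappa> / (d - \<alpha>)) / (d + \<alpha>) * (exp (d * s) - ?E)"
    using discounted_past_integral_exp_sum[OF s h _ disjI2[OF c(3)] disjI2[OF d(3)] disjI1[OF refl]]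
      p0\<alpha> by fastforce
  have xi: "xi \<alpha> xbar x0 \<sigma>S s = y + ?E * (z - y)"
    by (simp add: xi_def y_def z_def algebra_simps diff_divide_distrib add_divide_distrib)
  have r2': "\<kappa> * p\<^sub>1 * a + \<kappa> * p\<^sub>2 * b = - z + y * \<alpha> * (\<alpha> - 2 * \<nu> * (\<alpha> - \<kappa>)) / N"
    using r2 by (simp add: a_def b_def y_def z_def mult.commute)
  have "xi \<alpha> xbar x0 \<sigma>S s - f s + 2 * \<nu> * (exposure \<alpha> \<kappa> T f s - \<kappa> *
          integral {0..s} (\<lambda>u. exposure \<alpha> \<kappa> T f u * exp (- \<alpha> * (s - u))))
    = (y + ?E * (z - y) - p\<^sub>0
      + 2 * \<nu> * (p\<^sub>0 * (1 - \<kappa> / \<alpha>) - \<kappa> * (p\<^sub>0 * (1 - \<kappa> / \<alpha>) / \<alpha> * (1 - ?E))))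
      + (- p\<^sub>1 * exp (c * s) + 2 * \<nu> * (p\<^sub>1 * (1 + \<kappa> / (c - \<alpha>)) * exp (c * s)
          - \<kappa> * (p\<^sub>1 * (1 + \<kappa> / (c - \<alpha>)) / (c + \<alpha>) * (exp (c * s) - ?E))))
      + (- p\<^sub>2 * exp (d * s) + 2 * \<nu> * (p\<^sub>2 * (1 + \<kappa> / (d - \<alpha>)) * exp (d * s)
          - \<kappa> * (p\<^sub>2 * (1 + \<kappa> / (d - \<alpha>)) / (d + \<alpha>) * (exp (d * s) - ?E))))"
    unfolding F h[OF s] xi f[OF s] by (simp only: algebra_simps)
  also have "\<dots> = 0"
    using exp_term[OF ca a1, of p\<^sub>1 "exp (c * s)"] exp_term[OF db b1, of p\<^sub>2 "exp (d * s)"]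
      const_term c d unfolding r2'[symmetric]
    by (simp add: eq_neg_iff_add_eq_0 distrib_right)
  finally show "xi \<alpha> xbar x0 \<sigma>S s - f s
      + 2 * \<nu> * (exposure \<alpha> (\<sigma>x / \<sigma>S) T f s - \<sigma>x / \<sigma>S *
          integral {0..s} (\<lambda>u. exposure \<alpha> (\<sigma>x / \<sigma>S) T f u * exp (- \<alpha> * (s - u)))) = 0"
    by (simp add: \<kappa>_def)
qed

text \<open>For \<open>\<kappa>\<close> = 2 \<open>\<alpha>\<close> the exponents are
  \<open>\<alpha>\<close> and \<open>- \<alpha>\<close>, where the previous denominators vanish. A
  strategy without an \<open>exp (\<alpha> * s)\<close> term avoids the resonance:
  \<open>exposure\<close> sends \<open>exp (- \<alpha> * s)\<close> to a pure horizon term, as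
  \<open>1 + \<kappa> / (- \<alpha> - \<alpha>) = 0\<close>.\<close>

lemma extremal_exp_sum_degenerate:
  fixes \<alpha> \<sigma>x \<sigma>S \<nu> xbar x0 T p\<^sub>0 p :: real
  assumes "T > 0" "\<nu> < 0" "\<alpha> \<noteq> 0" and \<kappa>: "\<sigma>x / \<sigma>S = 2 * \<alpha>"
    and p0: "(1 - 2 * \<nu>) * p\<^sub>0 = xbar / \<sigma>S"
    and p: "p * (2 * \<nu> * exp (- 2 * \<alpha> * T) - 1)
      = - x0 / \<sigma>S + xbar / \<sigma>S - 4 * \<nu> * p\<^sub>0 * (exp (- \<alpha> * T) - 1)"
    and f: "\<And>s. s \<in> {0..T} \<Longrightarrow> f s = p\<^sub>0 + p * exp (- \<alpha> * s)"
  shows "extremal_strategy \<alpha> xbar x0 \<sigma>x \<sigma>S T \<nu> f"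
proof (rule extremal_if_euler_lagrange[OF \<open>T > 0\<close>])
  have "continuous_on {0..T} (\<lambda>s. p\<^sub>0 + p * exp (- \<alpha> * s))"
    by (intro continuous_intros)
  then show "continuous_on {0..T} f"
    by (rule continuous_on_eq) (simp add: f)
  \<comment> \<open>The coefficient of the horizon term \<open>exp (\<alpha> * u)\<close> in the
    exposure of \<open>f\<close>.\<close>
  define q where "q = exp (- \<alpha> * T) * (p * exp (- \<alpha> * T) + 2 * p\<^sub>0)"
  have f': "f s = p\<^sub>0 + 0 * exp (0 * s) + p * exp (- \<alpha> * s)" if "s \<in> {0..T}" for s
    using f[OF that] by simp
  have h: "exposure \<alpha> (2 * \<alpha>) T f u = - p\<^sub>0 + 0 * exp (0 * u) + 0 * exp (0 * u) + q * exp (\<alpha> * u)"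
    if "u \<in> {0..T}" for u
  proof -
    have E: "exp (\<alpha> * (u - T)) = exp (\<alpha> * u) * exp (- \<alpha> * T)"
      by (simp add: algebra_simps flip: exp_add)
    have "p * exp (- \<alpha> * T) / (- \<alpha> - \<alpha>) - p\<^sub>0 / \<alpha> = - (p * exp (- \<alpha> * T) + 2 * p\<^sub>0) / (2 * \<alpha>)"
      using \<open>\<alpha> \<noteq> 0\<close> by (simp add: field_simps)
    moreover have "1 + 2 * \<alpha> / (- \<alpha> - \<alpha>) = 0" using \<open>\<alpha> \<noteq> 0\<close> by (simp add: field_simps)
    ultimately show ?thesis
      using exposure_exp_sum[OF that f', where \<alpha> = \<alpha> and \<kappa> = "2 * \<alpha>"] \<open>\<alpha> \<noteq> 0\<close>
      unfolding E q_def by simp (simp add: algebra_simps)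
  qed
  fix s assume s: "s \<in> {0..T}"
  let ?E = "exp (- \<alpha> * s)"
  have F: "integral {0..s} (\<lambda>u. exposure \<alpha> (2 * \<alpha>) T f u * exp (- \<alpha> * (s - u)))
    = - p\<^sub>0 / \<alpha> * (1 - ?E) + q / (2 * \<alpha>) * (exp (\<alpha> * s) - ?E)"
    using discounted_past_integral_exp_sum[OF s h] \<open>\<alpha> \<noteq> 0\<close> by simp
  have E2: "exp (- 2 * \<alpha> * T) = exp (- \<alpha> * T) * exp (- \<alpha> * T)"
    by (simp flip: exp_add)
  define y z where "y = xbar / \<sigma>S" and "z = x0 / \<sigma>S"
  have xi: "xi \<alpha> xbar x0 \<sigma>S s = y + ?E * (z - y)"
    by (simp add: xi_def y_def z_def algebra_simps diff_divide_distrib add_divide_distrib)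
  \<comment> \<open>This is \<open>p\<close> rearranged: the coefficient of \<open>?E\<close> in the
    Euler-Lagrange equation vanishes. The terms in \<open>exp (\<alpha> * s)\<close> cancel by
    themselves.\<close>
  have "2 * \<nu> * q - p - 4 * \<nu> * p\<^sub>0 = y - z"
    using p unfolding E2 by (simp add: q_def y_def z_def algebra_simps)
  then have e: "?E * (2 * \<nu> * q - p - 4 * \<nu> * p\<^sub>0) = ?E * (y - z)" by simp
  have g: "2 * \<alpha> * (- p\<^sub>0 / \<alpha> * (1 - ?E) + q / (2 * \<alpha>) * (exp (\<alpha> * s) - ?E))
      = - 2 * p\<^sub>0 * (1 - ?E) + q * (exp (\<alpha> * s) - ?E)"
    using \<open>\<alpha> \<noteq> 0\<close> by (simp add: field_simps)
  show "xi \<alpha> xbar x0 \<sigma>S s - f s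
      + 2 * \<nu> * (exposure \<alpha> (\<sigma>x / \<sigma>S) T f s - \<sigma>x / \<sigma>S *
          integral {0..s} (\<lambda>u. exposure \<alpha> (\<sigma>x / \<sigma>S) T f u * exp (- \<alpha> * (s - u)))) = 0"
    unfolding \<kappa> F g h[OF s] xi f[OF s] using e p0[folded y_def] by (simp add: algebra_simps)
qed

section \<open>Exponents and invertibility of the coefficient matrix\<close>

lemma real_2x2_det_imp_invertible:
  fixes a b c d :: real
  assumes "a * d \<noteq> b * c"
  shows "invertible (vector [vector [a, b], vector [c, d]] :: real ^ 2 ^ 2)"
  using assms by (simp add: invertible_det_nz det_2)

lemma matrix_mult_matrix_inv:
  "invertible A \<Longrightarrow> A ** matrix_inv A = mat 1"
  unfolding invertible_def matrix_inv_def by (rule someI2_ex) auto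

text \<open>The number \<open>- coefC\<close> is a sum of the nonnegative terms
  \<open>\<alpha>\<^sup>2\<close> and \<open>- 2 * \<nu> * (\<alpha> - \<kappa>)\<^sup>2\<close>,
  which cannot both vanish because \<open>\<kappa>\<close> > 0.\<close>

lemma exponent_facts:
  fixes \<alpha> \<sigma>x \<sigma>S \<nu> T :: real
  defines "\<kappa> \<equiv> \<sigma>x / \<sigma>S"
  assumes "\<sigma>x > 0" "\<sigma>S > 0" "\<nu> < 0"
  shows "(1 - 2 * \<nu>) * (c1 \<alpha> \<sigma>x \<sigma>S \<nu>)\<^sup>2 = \<alpha>\<^sup>2 - 2 * \<nu> * (\<alpha> - \<kappa>)\<^sup>2"
    and "\<alpha>\<^sup>2 - 2 * \<nu> * (\<alpha> - \<kappa>)\<^sup>2 > 0"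
    and "c1 \<alpha> \<sigma>x \<sigma>S \<nu> > 0"
    and "c2 \<alpha> \<sigma>x \<sigma>S \<nu> = - c1 \<alpha> \<sigma>x \<sigma>S \<nu>"
proof -
  let ?N = "\<alpha>\<^sup>2 - 2 * \<nu> * (\<alpha> - \<kappa>)\<^sup>2"
  have \<kappa>: "\<kappa> > 0" using assms by simp
  have nn: "- 2 * \<nu> * (\<alpha> - \<kappa>)\<^sup>2 \<ge> 0" using \<open>\<nu> < 0\<close> by (simp add: mult_nonpos_nonneg)
  show N: "?N > 0"
  proof (cases "\<alpha> = 0")
    case True
    then show ?thesis using \<kappa> \<open>\<nu> < 0\<close> by (simp add: mult_neg_pos)
  next
    case False
    then have "\<alpha>\<^sup>2 > 0" by simp
    then show ?thesis using nn by linarith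
  qed
  have c: "c1 \<alpha> \<sigma>x \<sigma>S \<nu> = sqrt (?N / (1 - 2 * \<nu>))"
    by (simp add: c1_def coefC_def coefA_def \<kappa>_def)
  show "c1 \<alpha> \<sigma>x \<sigma>S \<nu> > 0" using N \<open>\<nu> < 0\<close> by (simp add: c)
  show "(1 - 2 * \<nu>) * (c1 \<alpha> \<sigma>x \<sigma>S \<nu>)\<^sup>2 = ?N" using N \<open>\<nu> < 0\<close> by (simp add: c)
  show "c2 \<alpha> \<sigma>x \<sigma>S \<nu> = - c1 \<alpha> \<sigma>x \<sigma>S \<nu>" by (simp add: c1_def c2_def)
qed

text \<open>\<open>c\<^sup>2\<close> is a proper convex combination of \<open>\<alpha>\<^sup>2\<close> and \<open>(\<alpha> - \<kappa>)\<^sup>2\<close>, which differ when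
  \<open>\<alpha> \<noteq> \<kappa> / 2\<close>, so it lies strictly between them.\<close>

lemma exponent_between:
  fixes \<alpha> \<kappa> \<nu> c :: real
  assumes "\<nu> < 0" "\<kappa> > 0" "\<alpha> \<noteq> \<kappa> / 2"
    and c: "(1 - 2 * \<nu>) * c\<^sup>2 = \<alpha>\<^sup>2 - 2 * \<nu> * (\<alpha> - \<kappa>)\<^sup>2"
  shows "(c\<^sup>2 - \<alpha>\<^sup>2) * (c\<^sup>2 - (\<alpha> - \<kappa>)\<^sup>2) < 0"
proof -
  have e: "c\<^sup>2 - \<alpha>\<^sup>2 = 2 * \<nu> * (c\<^sup>2 - (\<alpha> - \<kappa>)\<^sup>2)" using c by (simp add: algebra_simps)
  have "c\<^sup>2 \<noteq> (\<alpha> - \<kappa>)\<^sup>2"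
  proof
    assume "c\<^sup>2 = (\<alpha> - \<kappa>)\<^sup>2"
    then have "(\<alpha> - \<kappa>)\<^sup>2 = \<alpha>\<^sup>2" using e by simp
    then have "\<kappa> * (\<kappa> - 2 * \<alpha>) = 0" by algebra
    then show False using assms by simp
  qed
  then have "(c\<^sup>2 - (\<alpha> - \<kappa>)\<^sup>2)\<^sup>2 > 0" by simp
  then show ?thesis
    unfolding e using \<open>\<nu> < 0\<close> by (simp add: power2_eq_square mult.assoc mult_neg_pos)
qed

text \<open>A nonzero product excludes all zeros of the denominators in \<open>bmat\<close> and
  \<open>extremal_exp_sum\<close>, for \<open>c\<close> and for \<open>- c\<close>.\<close>

lemma exponent_nondegenerate:
  fixes \<alpha> \<kappa> c :: real
  assumes "(c\<^sup>2 - \<alpha>\<^sup>2) * (c\<^sup>2 - (\<alpha> - \<kappa>)\<^sup>2) < 0"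
  shows "c \<noteq> \<alpha>" "c \<noteq> - \<alpha>" "c + \<alpha> \<noteq> \<kappa>" "- c + \<alpha> \<noteq> \<kappa>"
proof -
  show "c \<noteq> \<alpha>" "c \<noteq> - \<alpha>" using assms by auto
  have "c\<^sup>2 \<noteq> (\<alpha> - \<kappa>)\<^sup>2" using assms by auto
  then have "c \<noteq> \<alpha> - \<kappa>" "- c \<noteq> \<alpha> - \<kappa>" by (auto simp: power2_eq_square algebra_simps)
  then show "c + \<alpha> \<noteq> \<kappa>" "- c + \<alpha> \<noteq> \<kappa>" by auto
qed

text \<open>The two terms of the determinant have opposite signs.\<close>

lemma bmat_invertible:
  fixes \<alpha> \<sigma>x \<sigma>S \<nu> T :: real
  assumes "\<sigma>x > 0" "\<sigma>S > 0" "\<nu> < 0" "\<alpha> \<noteq> \<sigma>x / \<sigma>S / 2"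
  shows "invertible (bmat \<alpha> \<sigma>x \<sigma>S T \<nu>)"
proof -
  define \<kappa> where "\<kappa> = \<sigma>x / \<sigma>S"
  define c where "c = c1 \<alpha> \<sigma>x \<sigma>S \<nu>"
  have \<kappa>: "\<kappa> > 0" "\<sigma>x = \<sigma>S * \<kappa>" using assms by (auto simp: \<kappa>_def)
  have c: "(1 - 2 * \<nu>) * c\<^sup>2 = \<alpha>\<^sup>2 - 2 * \<nu> * (\<alpha> - \<kappa>)\<^sup>2" "c2 \<alpha> \<sigma>x \<sigma>S \<nu> = - c"
    using exponent_facts[OF assms(1-3), of \<alpha>] by (auto simp: c_def \<kappa>_def)
  have btw: "(c\<^sup>2 - \<alpha>\<^sup>2) * (c\<^sup>2 - (\<alpha> - \<kappa>)\<^sup>2) < 0"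
    using exponent_between[OF \<open>\<nu> < 0\<close> \<kappa>(1) _ c(1)] assms(4) by (simp add: \<kappa>_def)
  note nd = exponent_nondegenerate[OF btw]
  \<comment> \<open>\<open>P\<close> and \<open>Q\<close> are the denominators of the two products
    in the determinant; regrouping the factors of \<open>P * Q\<close> yields the negative quantity
    in \<open>btw\<close>.\<close>
  define P where "P = (c - \<alpha>) * (- c + \<alpha> - \<kappa>)"
  define Q where "Q = (- c - \<alpha>) * (c + \<alpha> - \<kappa>)"
  have "P * Q = (c\<^sup>2 - \<alpha>\<^sup>2) * (c\<^sup>2 - (\<alpha> - \<kappa>)\<^sup>2)"
    by (simp add: P_def Q_def power2_eq_square algebra_simps)
  then have PQ: "P * Q < 0" using btw by simp
  then have "exp (c * T) * Q \<noteq> exp (- c * T) * P"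
    by (smt (verit) exp_gt_zero mult_less_0_iff mult_pos_pos mult_pos_neg)
  moreover have "P \<noteq> 0" "Q \<noteq> 0" using PQ by auto
  ultimately have "exp (c * T) / P \<noteq> exp (- c * T) / Q"
    by (simp add: frac_eq_eq)
  then have "exp (c * T) / P * \<kappa> \<noteq> exp (- c * T) / Q * \<kappa>"
    using \<kappa>(1) by (metis mult_right_cancel less_irrefl)
  then have det: "exp (c * T) / (c - \<alpha>) * (\<kappa> / (- c + \<alpha> - \<kappa>))
    \<noteq> exp (- c * T) / (- c - \<alpha>) * (\<kappa> / (c + \<alpha> - \<kappa>))"
    by (simp add: P_def Q_def)
  have row: "\<sigma>x / (\<sigma>S * (m + \<alpha>) - \<sigma>x) = \<kappa> / (m + \<alpha> - \<kappa>)" for m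
    using \<open>\<sigma>S > 0\<close> unfolding \<kappa>(2) by (simp flip: right_diff_distrib)
  show ?thesis
    unfolding bmat_def Let_def c(2) c_def[symmetric] row
    by (rule real_2x2_det_imp_invertible[OF det])
qed

section \<open>The explicit strategy and the classification\<close>

text \<open>The two rows of the linear system defining \<open>bvec\<close> are the conditions
  \<open>r1\<close> and \<open>r2\<close> of \<open>extremal_exp_sum\<close>; the case
  \<open>\<alpha>\<close> = \<open>\<kappa> / 2\<close> goes to the degenerate lemma.\<close>

lemma extremal_explicit_strategy:
  assumes "\<sigma>x > 0" "\<sigma>S > 0" "T > 0" "\<nu> < 0"
    and f: "\<forall>s\<in>{0..T}. f s = explicit_strategy \<alpha> xbar x0 \<sigma>x \<sigma>S T \<nu> s"
  shows "extremal_strategy \<alpha> xbar x0 \<sigma>x \<sigma>S T \<nu> f"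
proof -
  define \<kappa> where "\<kappa> = \<sigma>x / \<sigma>S"
  define c where "c = c1 \<alpha> \<sigma>x \<sigma>S \<nu>"
  define N where "N = \<alpha>\<^sup>2 - 2 * \<nu> * (\<alpha> - \<kappa>)\<^sup>2"
  define p where "p = b0 \<alpha> xbar \<sigma>x \<sigma>S \<nu>"
  define B where "B = bvec \<alpha> xbar x0 \<sigma>x \<sigma>S T \<nu>"
  have \<kappa>: "\<kappa> > 0" "\<sigma>x = \<sigma>S * \<kappa>" using assms by (auto simp: \<kappa>_def)
  have c: "(1 - 2 * \<nu>) * c\<^sup>2 = N" "N > 0" "c > 0" "c2 \<alpha> \<sigma>x \<sigma>S \<nu> = - c"
    using exponent_facts[OF assms(1,2,4), of \<alpha>] by (auto simp: c_def \<kappa>_def N_def)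
  have p: "p = \<alpha>\<^sup>2 * (xbar / \<sigma>S) / N"
    unfolding p_def b0_def coefD_def coefC_def N_def \<kappa>_def
    by (metis minus_diff_eq minus_divide_divide minus_minus)
  have f': "f s = p + B $ 1 * exp (c * s) + B $ 2 * exp (- c * s)" if "s \<in> {0..T}" for s
    using f that c by (simp add: explicit_strategy_def p_def B_def c_def)
  show ?thesis
  proof (cases "\<alpha> = \<kappa> / 2")
    case True
    have "\<alpha> - \<kappa> = - \<alpha>" using True by simp
    have N: "N = (1 - 2 * \<nu>) * \<alpha>\<^sup>2"
      unfolding N_def \<open>\<alpha> - \<kappa> = - \<alpha>\<close> by (simp add: left_diff_distrib)
    have "c = \<alpha>" using c(1) \<open>\<nu> < 0\<close> c(3) \<kappa>(1) True unfolding N by simp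
    have "\<alpha> \<noteq> 0" using True \<kappa>(1) by simp
    have p': "p = (xbar / \<sigma>S) / (1 - 2 * \<nu>)"
      unfolding p N using \<open>\<alpha> \<noteq> 0\<close> by simp
    have B: "B $ 1 = 0" "B $ 2 = (- x0 / \<sigma>S + (xbar / \<sigma>S)
        * (1 - (4 * \<nu> / (1 - 2 * \<nu>)) * (exp (- \<alpha> * T) - 1))) / (2 * \<nu> * exp (- 2 * \<alpha> * T) - 1)"
      using True by (simp_all add: B_def bvec_def \<kappa>_def)
    \<comment> \<open>The denominator in the degenerate branch of \<open>bvec\<close> is nonzero, so
      it can be cleared.\<close>
    have "2 * \<nu> * exp (- 2 * \<alpha> * T) - 1 < 0"
      using \<open>\<nu> < 0\<close> mult_neg_pos[of "2 * \<nu>" "exp (- 2 * \<alpha> * T)"] by simp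
    then have "B $ 2 * (2 * \<nu> * exp (- 2 * \<alpha> * T) - 1) = - x0 / \<sigma>S + (xbar / \<sigma>S)
        * (1 - (4 * \<nu> / (1 - 2 * \<nu>)) * (exp (- \<alpha> * T) - 1))"
      unfolding B(2) by simp
    also have "\<dots> = - x0 / \<sigma>S + xbar / \<sigma>S - 4 * \<nu> * p * (exp (- \<alpha> * T) - 1)"
    proof -
      have "y * (1 - m / n * e) = y - m * (y / n) * e" for y m n e :: real
        by (simp add: algebra_simps)
      then show ?thesis unfolding p' by simp
    qed
    finally have B2: "B $ 2 * (2 * \<nu> * exp (- 2 * \<alpha> * T) - 1)
      = - x0 / \<sigma>S + xbar / \<sigma>S - 4 * \<nu> * p * (exp (- \<alpha> * T) - 1)" .
    show ?thesis
    proof (rule extremal_exp_sum_degenerate[OF \<open>T > 0\<close> \<open>\<nu> < 0\<close> \<open>\<alpha> \<noteq> 0\<close> _ _ B2])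
      show "\<sigma>x / \<sigma>S = 2 * \<alpha>" using True by (simp add: \<kappa>_def)
      show "(1 - 2 * \<nu>) * p = xbar / \<sigma>S" using \<open>\<nu> < 0\<close> by (simp add: p')
      show "f s = p + B $ 2 * exp (- \<alpha> * s)" if "s \<in> {0..T}" for s
        using f'[OF that] B(1) \<open>c = \<alpha>\<close> by simp
    qed
  next
    case False
    note nd = exponent_nondegenerate[OF exponent_between[OF \<open>\<nu> < 0\<close> \<kappa>(1) False c(1)[unfolded N_def]]]
    have "\<alpha> \<noteq> 1/2 * (\<sigma>x / \<sigma>S)" using False by (simp add: \<kappa>_def)
    \<comment> \<open>Invertibility makes \<open>matrix_inv\<close> a genuine right inverse, so that
      \<open>B\<close> solves the linear system.\<close>
    then have "bmat \<alpha> \<sigma>x \<sigma>S T \<nu> *v B = brhs \<alpha> xbar x0 \<sigma>x \<sigma>S \<nu>"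
      using bmat_invertible[OF assms(1,2,4), of \<alpha> T]
      by (simp add: B_def bvec_def matrix_vector_mul_assoc matrix_mult_matrix_inv)
    then have r: "(bmat \<alpha> \<sigma>x \<sigma>S T \<nu> *v B) $ i = brhs \<alpha> xbar x0 \<sigma>x \<sigma>S \<nu> $ i" for i by simp
    have \<kappa>_row: "\<sigma>x / (\<sigma>S * (m + \<alpha>) - \<sigma>x) = \<kappa> / (m + \<alpha> - \<kappa>)" for m
      using \<open>\<sigma>S > 0\<close> unfolding \<kappa>(2) by (simp flip: right_diff_distrib)
    have r1: "B $ 1 * exp (c * T) / (c - \<alpha>) + B $ 2 * exp (- c * T) / (- c - \<alpha>)
        = \<alpha> * (xbar / \<sigma>S) / N"
      using r[of 1] unfolding bmat_def brhs_def Let_def c(4) c_def[symmetric] \<kappa>_row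
      by (simp add: matrix_vector_mult_def sum_2 N_def \<kappa>_def mult.commute)
    have r2: "B $ 1 * \<kappa> / (c + \<alpha> - \<kappa>) + B $ 2 * \<kappa> / (- c + \<alpha> - \<kappa>)
        = - x0 / \<sigma>S + (xbar / \<sigma>S) * \<alpha> * (\<alpha> - 2 * \<nu> * (\<alpha> - \<kappa>)) / N"
      using r[of 2] unfolding bmat_def brhs_def Let_def c(4) c_def[symmetric] \<kappa>_row
      by (simp add: matrix_vector_mult_def sum_2 N_def \<kappa>_def mult.commute)
    show ?thesis
      by (rule extremal_exp_sum[OF \<open>T > 0\<close>, of \<alpha> \<nu> \<sigma>x \<sigma>S c "- c" p xbar "B $ 1" "B $ 2" x0 f])
        (use c nd p r1 r2 f' in \<open>auto simp: N_def \<kappa>_def\<close>)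
  qed
qed

theorem theorem3p5:
  fixes \<alpha> xbar x0 \<sigma>x \<sigma>S T :: real
  assumes "\<sigma>x > 0" and "\<sigma>S > 0" and "T > 0"
  shows "(\<forall>f. optimal_strategy \<alpha> xbar x0 \<sigma>x \<sigma>S T f
                \<and> (\<exists>\<nu><0. extremal_strategy \<alpha> xbar x0 \<sigma>x \<sigma>S T \<nu> f)
              \<longleftrightarrow> (\<exists>\<nu><0. \<forall>s\<in>{0..T}. f s = explicit_strategy \<alpha> xbar x0 \<sigma>x \<sigma>S T \<nu> s))
    \<and> (\<forall>\<nu><0. \<forall>f. optimal_strategy \<alpha> xbar x0 \<sigma>x \<sigma>S T f
                    \<and> extremal_strategy \<alpha> xbar x0 \<sigma>x \<sigma>S T \<nu> f
              \<longleftrightarrow> (\<forall>s\<in>{0..T}. f s = explicit_strategy \<alpha> xbar x0 \<sigma>x \<sigma>S T \<nu> s))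
    \<and> (\<exists>N :: real \<Rightarrow> real. \<forall>f. optimal_strategy \<alpha> xbar x0 \<sigma>x \<sigma>S T f
                \<and> (\<exists>\<nu><0. extremal_strategy \<alpha> xbar x0 \<sigma>x \<sigma>S T \<nu> f)
              \<longrightarrow> N (var_fn \<alpha> \<sigma>x \<sigma>S T f) < 0
                \<and> (\<forall>s\<in>{0..T}. f s
                     = explicit_strategy \<alpha> xbar x0 \<sigma>x \<sigma>S T (N (var_fn \<alpha> \<sigma>x \<sigma>S T f)) s))
    \<and> (\<forall>\<nu><0. c1 \<alpha> \<sigma>x \<sigma>S \<nu> > 0
         \<and> (\<alpha> \<noteq> (1/2) * (\<sigma>x / \<sigma>S) \<longrightarrow>
              c1 \<alpha> \<sigma>x \<sigma>S \<nu> = \<bar>c2 \<alpha> \<sigma>x \<sigma>S \<nu>\<bar>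
              \<and> \<bar>c2 \<alpha> \<sigma>x \<sigma>S \<nu>\<bar> \<noteq> \<bar>\<alpha>\<bar>
              \<and> \<sigma>S * (c1 \<alpha> \<sigma>x \<sigma>S \<nu> + \<alpha>) - \<sigma>x \<noteq> 0
              \<and> \<sigma>S * (c2 \<alpha> \<sigma>x \<sigma>S \<nu> + \<alpha>) - \<sigma>x \<noteq> 0
              \<and> invertible (bmat \<alpha> \<sigma>x \<sigma>S T \<nu>))
         \<and> (\<alpha> = (1/2) * (\<sigma>x / \<sigma>S) \<longrightarrow>
              c1 \<alpha> \<sigma>x \<sigma>S \<nu> = \<alpha> \<and> c2 \<alpha> \<sigma>x \<sigma>S \<nu> = - \<alpha>))"


proof -
  let ?ext = "extremal_strategy \<alpha> xbar x0 \<sigma>x \<sigma>S T" and ?opt = "optimal_strategy \<alpha> xbar x0 \<sigma>x \<sigma>S T"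
  let ?var = "var_fn \<alpha> \<sigma>x \<sigma>S T"
  let ?F = "explicit_strategy \<alpha> xbar x0 \<sigma>x \<sigma>S T"
  \<comment> \<open>From left to right: \<open>?F \<nu>\<close> is itself extremal, so by uniqueness
    \<open>f\<close> agrees with it on the interval.\<close>
  have ext: "?ext \<nu> f \<longleftrightarrow> (\<forall>s\<in>{0..T}. f s = ?F \<nu> s)" if "\<nu> < 0" for \<nu> f
    using extremal_explicit_strategy[OF assms that] extremal_unique[OF that assms(3)] by metis
  have opt: "?opt f" if "\<nu> < 0" "?ext \<nu> f" for \<nu> f
    using extremal_imp_optimal that .
  \<comment> \<open>Any multiplier whose explicit strategy has variance \<open>v\<close> will do,
    since strategies of equal variance coincide by \<open>extremal_unique_of_variance\<close>. For
    variances that are not attained the value is arbitrary.\<close>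
  define N where "N v = (SOME \<nu>. \<nu> < 0 \<and> ?var (?F \<nu>) = v)" for v
  have N: "N (?var f) < 0 \<and> (\<forall>s\<in>{0..T}. f s = ?F (N (?var f)) s)"
    if f: "?opt f" "\<exists>\<nu><0. ?ext \<nu> f" for f
  proof -
    obtain \<nu> where \<nu>: "\<nu> < 0" "?ext \<nu> f" using f(2) by blast
    have "f s = ?F \<nu> s" if "s \<in> {0..T}" for s using ext \<nu> that by blast
    \<comment> \<open>Both the outer and the inner integral of \<open>var_fn\<close> see only values
      on the interval, where the two strategies agree.\<close>
    then have "?var (?F \<nu>) = ?var f"
      unfolding var_fn_def by (intro Henstock_Kurzweil_Integration.integral_cong
          arg_cong[where f = "\<lambda>x. x\<^sup>2"] arg_cong2[where f = "(-)"] arg_cong2[where f = "(*)"]) auto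
    with \<nu> have "\<exists>\<nu>. \<nu> < 0 \<and> ?var (?F \<nu>) = ?var f" by blast
    then have *: "N (?var f) < 0 \<and> ?var (?F (N (?var f))) = ?var f"
      unfolding N_def by (rule someI_ex)
    then show ?thesis
      using extremal_unique_of_variance[OF _ assms(3) _ f(1), of "N (?var f)" "?F (N (?var f))"] ext
      by auto
  qed
  have exponents: "c1 \<alpha> \<sigma>x \<sigma>S \<nu> > 0
         \<and> (\<alpha> \<noteq> (1/2) * (\<sigma>x / \<sigma>S) \<longrightarrow>
              c1 \<alpha> \<sigma>x \<sigma>S \<nu> = \<bar>c2 \<alpha> \<sigma>x \<sigma>S \<nu>\<bar>
              \<and> \<bar>c2 \<alpha> \<sigma>x \<sigma>S \<nu>\<bar> \<noteq> \<bar>\<alpha>\<bar>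
              \<and> \<sigma>S * (c1 \<alpha> \<sigma>x \<sigma>S \<nu> + \<alpha>) - \<sigma>x \<noteq> 0
              \<and> \<sigma>S * (c2 \<alpha> \<sigma>x \<sigma>S \<nu> + \<alpha>) - \<sigma>x \<noteq> 0
              \<and> invertible (bmat \<alpha> \<sigma>x \<sigma>S T \<nu>))
         \<and> (\<alpha> = (1/2) * (\<sigma>x / \<sigma>S) \<longrightarrow>
              c1 \<alpha> \<sigma>x \<sigma>S \<nu> = \<alpha> \<and> c2 \<alpha> \<sigma>x \<sigma>S \<nu> = - \<alpha>)" if \<nu>: "\<nu> < 0" for \<nu>
  proof -
    define c where "c = c1 \<alpha> \<sigma>x \<sigma>S \<nu>"
    note c = exponent_facts[OF assms(1,2) \<nu>, of \<alpha>, folded c_def]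
    show ?thesis
      unfolding c(4) c_def[symmetric]
    proof (intro conjI impI)
      show "c > 0" by (rule c)
    next
      assume "\<alpha> = (1/2) * (\<sigma>x / \<sigma>S)"
      then have k: "\<sigma>x / \<sigma>S = 2 * \<alpha>" by simp
      moreover have "\<alpha> > 0" using k assms by (metis divide_pos_pos zero_less_mult_pos zero_less_numeral)
      \<comment> \<open>Here \<open>\<alpha> - \<sigma>x / \<sigma>S\<close> equals
        \<open>- \<alpha>\<close>, so both squares in the formula for \<open>c\<^sup>2\<close> are
        \<open>\<alpha>\<^sup>2\<close>.\<close>
      moreover have "(1 - 2 * \<nu>) * c\<^sup>2 = (1 - 2 * \<nu>) * \<alpha>\<^sup>2"
        using c(1) unfolding k by (simp add: algebra_simps power2_eq_square)
      ultimately show "c = \<alpha>" using \<nu> c(3) by simp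
      then show "- c = - \<alpha>" by simp
    next
      assume a: "\<alpha> \<noteq> (1/2) * (\<sigma>x / \<sigma>S)"
      note nd = exponent_nondegenerate[OF exponent_between[OF \<nu> divide_pos_pos[OF assms(1,2)] _ c(1)]]
      show "c = \<bar>- c\<bar>" using c(3) by simp
      show "\<bar>- c\<bar> \<noteq> \<bar>\<alpha>\<bar>" using nd a c(3) by (auto simp: abs_if)
      show "\<sigma>S * (c + \<alpha>) - \<sigma>x \<noteq> 0" "\<sigma>S * (- c + \<alpha>) - \<sigma>x \<noteq> 0"
        using nd(3,4) a assms(2) by (auto simp: field_simps)
      show "invertible (bmat \<alpha> \<sigma>x \<sigma>S T \<nu>)"
        using bmat_invertible[OF assms(1,2) \<nu>] a by simp
    qed
  qed
  show ?thesis
    using ext opt N exponents by blast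
qed

end
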